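(* The category $\mathsf{MPS}$ of modal Priestley spaces and continuous p-morphisms is isomorphic to the category $\mathsf{Coalg}(\mathcal{C})$ of coalgebras for the endofunctor $\mathcal{C}:\mathsf{PS}\to\mathsf{PS}$.
   Context: A Priestley space is a compact space with a partial order $\le$ such that if $x\nleq y$ then there is a clopen upset containing $x$ and missing $y$; $\mathsf{PS}$ is the category of Priestley spaces and continuous order-preserving maps. For $X\in\mathsf{PS}$, $\mathcal{C}(X)$ is the set of closed subsets $C$ of $X$ (including $\varnothing$) that are convex ($x,y\in C$ and $x\le z\le y$ imply $z\in C$), partially ordered by the Egli-Milner order ($A\sqsubseteq B$ iff $A\subseteq{\downarrow}B$ and $B\subseteq{\uparrow}A$), with the topology generated by the sets $\{C\mid C\cap S\neq\varnothing\}$ and $\{C\mid C\cap S=\varnothing\}$, where $S$ ranges over the clopen upsets and the clopen downsets of $X$; this is a Priestley space. For $f:X\to Y$ in $\mathsf{PS}$, $\mathcal{C}(f)(C)={\uparrow}f(C)\cap{\downarrow}f(C)$. A coalgebra for $\mathcal{C}$ is a pair $(X,\rho)$ with $X\in\mathsf{PS}$ and $\rho:X\to\mathcal{C}(X)$ a $\mathsf{PS}$-morphism; a morphism $(X_1,\rho_1)\to(X_2,\rho_2)$ is a $\mathsf{PS}$-morphism $\alpha:X_1\to X_2$ with $\mathcal{C}(\alpha)\circ\rho_1=\rho_2\circ\alpha$. For a binary relation $R$ on $X$, $R[x]=\{y\mid x\,R\,y\}$, and for $U\subseteq X$, $\Box_R U=\{x\mid R[x]\subseteq U\}$ and $\Diamond_R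 U=R^{-1}[U]=\{x\mid R[x]\cap U\neq\varnothing\}$. A modal Priestley space is a pair $(X,R)$ where $X$ is a Priestley space and $R$ is a binary relation on $X$ such that (1) $R[x]$ is closed for each $x\in X$; (2) if $U$ is a clopen upset then $\Box_R U$ and $\Diamond_R U$ are clopen upsets; (3) $R[x]={\uparrow}R[x]\cap{\downarrow}R[x]$ for each $x\in X$. A map $f:X_1\to X_2$ between modal Priestley spaces $(X_1,R_1)$, $(X_2,R_2)$ is a p-morphism if (1) $f$ is order-preserving; (2) $x\,R_1\,z$ implies $f(x)\,R_2\,f(z)$; (3) $f(x)\,R_2\,y$ implies there exist $z,z'\in X_1$ with $x\,R_1\,z$, $x\,R_1\,z'$ and $f(z)\le y\le f(z')$. *)

theory Defs
  imports "HOL-Analysis.Analysis"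
begin

text \<open>
  A category consists of a set of objects, a set of morphisms for every pair of objects, identities,
  and composition maps from Hom B D times Hom A B to Hom A D, written Comp A B D g f.  Hom-sets of
  distinct pairs need not be disjoint: domain and codomain are carried by the indices.
\<close>

record ('o, 'm) cat =
  Ob :: "'o set"
  Hom :: "'o \<Rightarrow> 'o \<Rightarrow> 'm set"
  Ident :: "'o \<Rightarrow> 'm"
  Comp :: "'o \<Rightarrow> 'o \<Rightarrow> 'o \<Rightarrow> 'm \<Rightarrow> 'm \<Rightarrow> 'm"

locale category =
  fixes C :: "('o, 'm) cat"
  assumes ident_in_hom: "A \<in> Ob C \<Longrightarrow> Ident C A \<in> Hom C A A"
    and comp_in_hom:
      "\<lbrakk>A \<in> Ob C; B \<in> Ob C; D \<in> Ob C; f \<in> Hom C A B; g \<in> Hom C B D\<rbrakk>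
        \<Longrightarrow> Comp C A B D g f \<in> Hom C A D"
    and comp_ident_right:
      "\<lbrakk>A \<in> Ob C; B \<in> Ob C; f \<in> Hom C A B\<rbrakk> \<Longrightarrow> Comp C A A B f (Ident C A) = f"
    and comp_ident_left:
      "\<lbrakk>A \<in> Ob C; B \<in> Ob C; f \<in> Hom C A B\<rbrakk> \<Longrightarrow> Comp C A B B (Ident C B) f = f"
    and comp_assoc:
      "\<lbrakk>A \<in> Ob C; B \<in> Ob C; D \<in> Ob C; E \<in> Ob C; f \<in> Hom C A B; g \<in> Hom C B D; h \<in> Hom C D E\<rbrakk>
        \<Longrightarrow> Comp C A D E h (Comp C A B D g f) = Comp C A B E (Comp C B D E h g) f"

record ('o, 'm, 'p, 'n) fctr =
  fob :: "'o \<Rightarrow> 'p"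
  fmap :: "'o \<Rightarrow> 'o \<Rightarrow> 'm \<Rightarrow> 'n"

definition is_functor ::
    "('o, 'm) cat \<Rightarrow> ('p, 'n) cat \<Rightarrow> ('o, 'm, 'p, 'n) fctr \<Rightarrow> bool" where
  "is_functor C D F \<longleftrightarrow>
     category C \<and> category D \<and>
     (\<forall>A\<in>Ob C. fob F A \<in> Ob D) \<and>
     (\<forall>A\<in>Ob C. \<forall>B\<in>Ob C. \<forall>f\<in>Hom C A B. fmap F A B f \<in> Hom D (fob F A) (fob F B)) \<and>
     (\<forall>A\<in>Ob C. fmap F A A (Ident C A) = Ident D (fob F A)) \<and>
     (\<forall>A\<in>Ob C. \<forall>B\<in>Ob C. \<forall>E\<in>Ob C. \<forall>f\<in>Hom C A B. \<forall>g\<in>Hom C B E.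
        fmap F A E (Comp C A B E g f) =
          Comp D (fob F A) (fob F B) (fob F E) (fmap F B E g) (fmap F A B f))"

text \<open>The composite functor G after F is the identity functor on C.\<close>

definition left_inverse_functor ::
    "('o, 'm) cat \<Rightarrow> ('o, 'm, 'p, 'n) fctr \<Rightarrow> ('p, 'n, 'o, 'm) fctr \<Rightarrow> bool" where
  "left_inverse_functor C F G \<longleftrightarrow>
     (\<forall>A\<in>Ob C. fob G (fob F A) = A) \<and>
     (\<forall>A\<in>Ob C. \<forall>B\<in>Ob C. \<forall>f\<in>Hom C A B.
        fmap G (fob F A) (fob F B) (fmap F A B f) = f)"

definition isomorphic_categories :: "('o, 'm) cat \<Rightarrow> ('p, 'n) cat \<Rightarrow> bool" where
  "isomorphic_categories C D \<longleftrightarrow>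
     (\<exists>F G. is_functor C D F \<and> is_functor D C G \<and>
            left_inverse_functor C F G \<and> left_inverse_functor D G F)"

record 'a ospace =
  topo :: "'a topology"
  le :: "'a rel"

abbreviation pts :: "'a ospace \<Rightarrow> 'a set" where
  "pts X \<equiv> topspace (topo X)"

definition up :: "'a ospace \<Rightarrow> 'a set \<Rightarrow> 'a set" where
  "up X A = {y. \<exists>x\<in>A. (x, y) \<in> le X}"

definition down :: "'a ospace \<Rightarrow> 'a set \<Rightarrow> 'a set" where
  "down X A = {y. \<exists>x\<in>A. (y, x) \<in> le X}"

definition clopen_upset :: "'a ospace \<Rightarrow> 'a set \<Rightarrow> bool" where
  "clopen_upset X U \<longleftrightarrow>
     openin (topo X) U \<and> closedin (topo X) U \<and> (\<forall>x y. x \<in> U \<and> (x, y) \<in> le X \<longrightarrow> y \<in> U)"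

definition clopen_downset :: "'a ospace \<Rightarrow> 'a set \<Rightarrow> bool" where
  "clopen_downset X U \<longleftrightarrow>
     openin (topo X) U \<and> closedin (topo X) U \<and> (\<forall>x y. y \<in> U \<and> (x, y) \<in> le X \<longrightarrow> x \<in> U)"

definition priestley_space :: "'a ospace \<Rightarrow> bool" where
  "priestley_space X \<longleftrightarrow>
     compact_space (topo X) \<and>
     partial_order_on (pts X) (le X) \<and>
     (\<forall>x\<in>pts X. \<forall>y\<in>pts X. (x, y) \<notin> le X \<longrightarrow> (\<exists>U. clopen_upset X U \<and> x \<in> U \<and> y \<notin> U))"

text \<open>
  Maps between spaces are HOL functions that are undefined outside the carrier of the domain, so that
  two of them are equal as soon as they agree on the carrier.
\<close>

definition ps_hom :: "'a ospace \<Rightarrow> 'b ospace \<Rightarrow> ('a \<Rightarrow> 'b) set" where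
  "ps_hom X Y = {f. priestley_space X \<and> priestley_space Y \<and>
     f \<in> extensional (pts X) \<and> continuous_map (topo X) (topo Y) f \<and>
     (\<forall>x y. (x, y) \<in> le X \<longrightarrow> (f x, f y) \<in> le Y)}"

definition closed_convex :: "'a ospace \<Rightarrow> 'a set set" where
  "closed_convex X = {C. closedin (topo X) C \<and>
     (\<forall>x\<in>C. \<forall>y\<in>C. \<forall>z. (x, z) \<in> le X \<and> (z, y) \<in> le X \<longrightarrow> z \<in> C)}"

definition egli_milner :: "'a ospace \<Rightarrow> 'a set rel" where
  "egli_milner X = {(A, B). A \<in> closed_convex X \<and> B \<in> closed_convex X \<and>
     A \<subseteq> down X B \<and> B \<subseteq> up X A}"

text \<open>
  The carrier of the generated topology is the union of the generating sets, which is all of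
  closed_convex X, because every C misses the clopen upset {}.
\<close>

definition vietoris_topology :: "'a ospace \<Rightarrow> 'a set topology" where
  "vietoris_topology X = topology_generated_by
     ({{C \<in> closed_convex X. C \<inter> S \<noteq> {}} | S. clopen_upset X S \<or> clopen_downset X S} \<union>
      {{C \<in> closed_convex X. C \<inter> S = {}} | S. clopen_upset X S \<or> clopen_downset X S})"

text \<open>
  Since the points of the new space are sets of points of X, the functor leads from Priestley spaces
  over the type 'a to Priestley spaces over the type 'a set.
\<close>

definition Vietoris :: "('a ospace, 'a \<Rightarrow> 'a, 'a set ospace, 'a set \<Rightarrow> 'a set) fctr" where
  "Vietoris = \<lparr>
     fob = (\<lambda>X. \<lparr>topo = vietoris_topology X, le = egli_milner X\<rparr>),
     fmap = (\<lambda>X Y f. \<lambda>C\<in>closed_convex X. up Y (f ` C) \<inter> down Y (f ` C))\<rparr>"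

definition coalg_hom ::
    "('a ospace, 'a \<Rightarrow> 'a, 'b ospace, 'b \<Rightarrow> 'b) fctr \<Rightarrow>
     'a ospace \<times> ('a \<Rightarrow> 'b) \<Rightarrow> 'a ospace \<times> ('a \<Rightarrow> 'b) \<Rightarrow> ('a \<Rightarrow> 'a) set" where
  "coalg_hom F = (\<lambda>(X1, \<rho>1) (X2, \<rho>2). {\<alpha> \<in> ps_hom X1 X2.
     compose (pts X1) (fmap F X1 X2 \<alpha>) \<rho>1 = compose (pts X1) \<rho>2 \<alpha>})"

definition Coalg ::
    "('a ospace, 'a \<Rightarrow> 'a, 'b ospace, 'b \<Rightarrow> 'b) fctr \<Rightarrow>
     ('a ospace \<times> ('a \<Rightarrow> 'b), 'a \<Rightarrow> 'a) cat" where
  "Coalg F = \<lparr>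
     Ob = {(X, \<rho>). priestley_space X \<and> \<rho> \<in> ps_hom X (fob F X)},
     Hom = coalg_hom F,
     Ident = (\<lambda>(X, \<rho>). \<lambda>x\<in>pts X. x),
     Comp = (\<lambda>(X1, \<rho>1) _ _ \<beta> \<alpha>. compose (pts X1) \<beta> \<alpha>)\<rparr>"

definition box :: "'a ospace \<Rightarrow> 'a rel \<Rightarrow> 'a set \<Rightarrow> 'a set" where
  "box X R U = {x \<in> pts X. R `` {x} \<subseteq> U}"

definition diamond :: "'a ospace \<Rightarrow> 'a rel \<Rightarrow> 'a set \<Rightarrow> 'a set" where
  "diamond X R U = {x \<in> pts X. R `` {x} \<inter> U \<noteq> {}}"

definition modal_priestley_space :: "'a ospace \<Rightarrow> 'a rel \<Rightarrow> bool" where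
  "modal_priestley_space X R \<longleftrightarrow>
     priestley_space X \<and> R \<subseteq> pts X \<times> pts X \<and>
     (\<forall>x\<in>pts X. closedin (topo X) (R `` {x})) \<and>
     (\<forall>U. clopen_upset X U \<longrightarrow> clopen_upset X (box X R U) \<and> clopen_upset X (diamond X R U)) \<and>
     (\<forall>x\<in>pts X. R `` {x} = up X (R `` {x}) \<inter> down X (R `` {x}))"

definition p_morphism ::
    "'a ospace \<Rightarrow> 'a rel \<Rightarrow> 'b ospace \<Rightarrow> 'b rel \<Rightarrow> ('a \<Rightarrow> 'b) \<Rightarrow> bool" where
  "p_morphism X1 R1 X2 R2 f \<longleftrightarrow>
     f \<in> pts X1 \<rightarrow> pts X2 \<and>
     (\<forall>x y. (x, y) \<in> le X1 \<longrightarrow> (f x, f y) \<in> le X2) \<and>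
     (\<forall>x z. (x, z) \<in> R1 \<longrightarrow> (f x, f z) \<in> R2) \<and>
     (\<forall>x\<in>pts X1. \<forall>y. (f x, y) \<in> R2 \<longrightarrow>
        (\<exists>z z'. (x, z) \<in> R1 \<and> (x, z') \<in> R1 \<and> (f z, y) \<in> le X2 \<and> (y, f z') \<in> le X2))"

definition MPS :: "('a ospace \<times> 'a rel, 'a \<Rightarrow> 'a) cat" where
  "MPS = \<lparr>
     Ob = {(X, R). modal_priestley_space X R},
     Hom = (\<lambda>(X1, R1) (X2, R2). {f \<in> extensional (pts X1).
       continuous_map (topo X1) (topo X2) f \<and> p_morphism X1 R1 X2 R2 f}),
     Ident = (\<lambda>(X, R). \<lambda>x\<in>pts X. x),
     Comp = (\<lambda>(X1, R1) _ _ g f. compose (pts X1) g f)\<rparr>"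

end

theory Submission
  imports Defs
begin

text \<open>
  The isomorphism sends (X, R) to (X, \<lambda>x. R[x]) and is the identity on morphisms.  For S a clopen
  upset or downset, the preimage of the subbasic set of all C meeting S is the set of x with R[x]
  meeting S; hence continuity and monotonicity of the map x \<mapsto> R[x] match condition (2) on R, where
  monotonicity uses that a clopen upset separates a point from a closed set.  The two notions of
  morphism agree because each R[x] is convex.  The remaining content is that the Vietoris space is
  a Priestley space, whose compactness comes from Alexander's subbase lemma.
\<close>

section \<open>Compactness from a subbase\<close>

text \<open>\<open>Alexander_subbase\<close> speaks of a topology \<open>Y\<close> built from finite
  intersections relative to the union of the subbase. Compactness passes from \<open>Y\<close> to
  the generated topology along the identity map.\<close>

lemma compact_space_topology_generated_by:
  assumes fin: "\<And>\<C>. \<lbrakk>\<C> \<subseteq> \<B>; \<Union>\<C> = \<Union>\<B>\<rbrakk> \<Longrightarrow> \<exists>\<C>'. finite \<C>' \<and> \<C>' \<subseteq> \<C> \<and> \<Union>\<C>' = \<Union>\<B>"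
  shows "compact_space (topology_generated_by \<B>)"
proof -
  define Y where
    "Y = topology (arbitrary union_of (finite intersection_of (\<lambda>x. x \<in> \<B>) relative_to \<Union>\<B>))"
  have top: "topspace Y = \<Union>\<B>"
    by (simp add: Y_def)
  have "compact_space Y"
    by (rule Alexander_subbase [of \<B>]) (use fin in \<open>simp_all add: top flip: Y_def\<close>)
  have "openin Y S" if "S \<in> \<B>" for S
  proof -
    have "(finite intersection_of (\<lambda>x. x \<in> \<B>)) S"
      using that by (simp add: finite_intersection_of_inc)
    then have "(finite intersection_of (\<lambda>x. x \<in> \<B>) relative_to \<Union>\<B>) S"
      using that unfolding relative_to_def by (intro exI [of _ S]) auto
    then show ?thesis
      unfolding Y_def openin_subbase by (rule arbitrary_union_of_inc)
  qed
  \<comment> \<open>Only this direction is needed: every generator is open in \<open>Y\<close>, so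
    the generated topology is a continuous image of \<open>Y\<close>.\<close>
  then have "continuous_map Y (topology_generated_by \<B>) id"
    by (intro continuous_on_generated_topo) (auto simp: top)
  from image_compactin [OF \<open>compact_space Y\<close> [unfolded compact_space_def] this]
  show ?thesis
    by (simp add: compact_space_def top)
qed

section \<open>Clopen upsets and separation in Priestley spaces\<close>

lemma priestley_space_le:
  assumes "priestley_space X"
  shows "le X \<subseteq> pts X \<times> pts X" "\<And>x. x \<in> pts X \<Longrightarrow> (x, x) \<in> le X"
    "\<And>x y z. (x, y) \<in> le X \<Longrightarrow> (y, z) \<in> le X \<Longrightarrow> (x, z) \<in> le X"
    "\<And>x y. (x, y) \<in> le X \<Longrightarrow> (y, x) \<in> le X \<Longrightarrow> x = y"
  using assms unfolding priestley_space_def partial_order_on_def preorder_on_def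
  by (auto dest: antisymD transD refl_onD)

lemma clopen_upset_Diff:
  assumes "priestley_space X" "clopen_downset X D"
  shows "clopen_upset X (pts X - D)"
  using assms(2) priestley_space_le(1) [OF assms(1)]
  unfolding clopen_upset_def clopen_downset_def by (auto intro: openin_diff closedin_diff)

lemma clopen_downset_Diff:
  assumes "priestley_space X" "clopen_upset X U"
  shows "clopen_downset X (pts X - U)"
  using assms(2) priestley_space_le(1) [OF assms(1)]
  unfolding clopen_upset_def clopen_downset_def by (auto intro: openin_diff closedin_diff)

lemma clopen_upset_UNION:
  assumes "finite I" "\<And>i. i \<in> I \<Longrightarrow> clopen_upset X (U i)"
  shows "clopen_upset X (\<Union>i\<in>I. U i)"
  using assms unfolding clopen_upset_def by (auto intro!: closedin_Union)

text \<open>The index set must be nonempty because the empty intersection is the whole type, which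
  may exceed the carrier.\<close>

lemma clopen_upset_INTER:
  assumes "finite I" "I \<noteq> {}" "\<And>i. i \<in> I \<Longrightarrow> clopen_upset X (U i)"
  shows "clopen_upset X (\<Inter>i\<in>I. U i)"
  using assms unfolding clopen_upset_def by (auto intro!: closedin_Inter openin_Inter)

lemma clopen_upset_empty: "clopen_upset X {}"
  by (simp add: clopen_upset_def)

lemma clopen_upset_pts:
  assumes "priestley_space X"
  shows "clopen_upset X (pts X)"
  using priestley_space_le(1) [OF assms] by (auto simp: clopen_upset_def)

text \<open>Compactness strengthens the separation axiom: each \<open>b\<close> in \<open>B\<close>
  is missed by a clopen upset around \<open>a\<close>, the complements of these upsets cover
  \<open>B\<close>, and the upsets of a finite subcover are intersected.\<close>

lemma separate_point_from_closed:
  assumes X: "priestley_space X" and B: "closedin (topo X) B" and a: "a \<in> pts X" "a \<notin> down X B"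
  shows "\<exists>U. clopen_upset X U \<and> a \<in> U \<and> U \<inter> B = {}"
proof -
  have BX: "B \<subseteq> pts X"
    using B by (rule closedin_subset)
  have "\<forall>b\<in>B. \<exists>U. clopen_upset X U \<and> a \<in> U \<and> b \<notin> U"
    using X a BX unfolding priestley_space_def down_def by blast
  then obtain U where U: "\<And>b. b \<in> B \<Longrightarrow> clopen_upset X (U b) \<and> a \<in> U b \<and> b \<notin> U b"
    by metis
  have "compactin (topo X) B"
    using X B by (simp add: closedin_compact_space priestley_space_def)
  then have "\<exists>\<F>. finite \<F> \<and> \<F> \<subseteq> (\<lambda>b. pts X - U b) ` B \<and> B \<subseteq> \<Union>\<F>"
    by (rule compactinD) (use U BX in \<open>auto simp: clopen_upset_def\<close>)
  then obtain I where I: "finite I" "I \<subseteq> B" "B \<subseteq> (\<Union>b\<in>I. pts X - U b)"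
    by (auto simp: ex_finite_subset_image)
  show ?thesis
  \<comment> \<open>An empty subcover forces \<open>B\<close> to be empty, and then the whole
    carrier separates.\<close>
  proof (cases "I = {}")
    case True
    then show ?thesis
      using I a clopen_upset_pts [OF X] by auto
  next
    case False
    have "clopen_upset X (\<Inter>b\<in>I. U b)"
      by (rule clopen_upset_INTER) (use I U False in auto)
    then show ?thesis
      using I U by (intro exI [of _ "\<Inter>b\<in>I. U b"]) blast
  qed
qed

text \<open>Dual argument: here the clopen upsets themselves cover \<open>A\<close>, and a finite
  union still misses \<open>b\<close>.\<close>

lemma separate_closed_from_point:
  assumes X: "priestley_space X" and A: "closedin (topo X) A" and b: "b \<in> pts X" "b \<notin> up X A"
  shows "\<exists>U. clopen_upset X U \<and> A \<subseteq> U \<and> b \<notin> U"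
proof -
  have AX: "A \<subseteq> pts X"
    using A by (rule closedin_subset)
  have "\<forall>a\<in>A. \<exists>U. clopen_upset X U \<and> a \<in> U \<and> b \<notin> U"
    using X b AX unfolding priestley_space_def up_def by blast
  then obtain U where U: "\<And>a. a \<in> A \<Longrightarrow> clopen_upset X (U a) \<and> a \<in> U a \<and> b \<notin> U a"
    by metis
  have "compactin (topo X) A"
    using X A by (simp add: closedin_compact_space priestley_space_def)
  then have "\<exists>\<F>. finite \<F> \<and> \<F> \<subseteq> U ` A \<and> A \<subseteq> \<Union>\<F>"
    by (rule compactinD) (use U in \<open>auto simp: clopen_upset_def\<close>)
  then obtain I where I: "finite I" "I \<subseteq> A" "A \<subseteq> (\<Union>a\<in>I. U a)"
    by (auto simp: ex_finite_subset_image)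
  have "clopen_upset X (\<Union>a\<in>I. U a)"
    by (rule clopen_upset_UNION) (use I U in auto)
  then show ?thesis
    using I U by (intro exI [of _ "\<Union>a\<in>I. U a"]) blast
qed

section \<open>The Vietoris topology and its compactness\<close>

abbreviation hit :: "'a ospace \<Rightarrow> 'a set \<Rightarrow> 'a set set" where
  "hit X S \<equiv> {C \<in> closed_convex X. C \<inter> S \<noteq> {}}"

abbreviation miss :: "'a ospace \<Rightarrow> 'a set \<Rightarrow> 'a set set" where
  "miss X S \<equiv> {C \<in> closed_convex X. C \<inter> S = {}}"

definition vietoris_subbase :: "'a ospace \<Rightarrow> 'a set set set" where
  "vietoris_subbase X =
     {hit X S | S. clopen_upset X S \<or> clopen_downset X S} \<union>
     {miss X S | S. clopen_upset X S \<or> clopen_downset X S}"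

lemma vietoris_subbaseE:
  assumes "\<V> \<in> vietoris_subbase X"
  obtains S where "clopen_upset X S \<or> clopen_downset X S" "\<V> = hit X S \<or> \<V> = miss X S"
  using assms unfolding vietoris_subbase_def
  by (elim UnE CollectE exE conjE) (rule that, assumption, simp)+

lemma vietoris_topology_eq: "vietoris_topology X = topology_generated_by (vietoris_subbase X)"
  by (simp add: vietoris_topology_def vietoris_subbase_def)

lemma Union_vietoris_subbase: "\<Union>(vietoris_subbase X) = closed_convex X"
proof -
  have "miss X {} \<in> vietoris_subbase X"
    using clopen_upset_empty unfolding vietoris_subbase_def by blast
  then show ?thesis
    unfolding vietoris_subbase_def by auto
qed

lemma topspace_vietoris [simp]: "topspace (vietoris_topology X) = closed_convex X"
  by (simp add: vietoris_topology_eq Union_vietoris_subbase)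

lemma openin_vietoris:
  assumes "clopen_upset X S \<or> clopen_downset X S"
  shows "openin (vietoris_topology X) (hit X S)" "openin (vietoris_topology X) (miss X S)"
  unfolding vietoris_topology_eq
  by (rule topology_generated_by_Basis, use assms in \<open>auto simp: vietoris_subbase_def\<close>)+

text \<open>The hit set and the miss set of one \<open>S\<close> are complementary, so all
  generators are clopen.\<close>

lemma closedin_vietoris:
  assumes "clopen_upset X S \<or> clopen_downset X S"
  shows "closedin (vietoris_topology X) (hit X S)" "closedin (vietoris_topology X) (miss X S)"
proof -
  have "closed_convex X - hit X S = miss X S" "closed_convex X - miss X S = hit X S"
    by auto
  then show "closedin (vietoris_topology X) (hit X S)" "closedin (vietoris_topology X) (miss X S)"
    using openin_vietoris [OF assms] by (auto simp: closedin_def)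
qed

text \<open>
  Given a cover by subbasic sets, let H collect the sets S whose hit sets belong to the
  cover.  The complement of the union of H is an intersection of a closed downset and a closed
  upset, so it is a point of the space, and it must be covered by the miss set of some S; this S
  is compact and lies in the union of H.
\<close>

lemma compact_space_vietoris:
  assumes X: "priestley_space X"
  shows "compact_space (vietoris_topology X)"
  unfolding vietoris_topology_eq
proof (rule compact_space_topology_generated_by, unfold Union_vietoris_subbase)
  fix \<C>
  assume sub: "\<C> \<subseteq> vietoris_subbase X" and cov: "\<Union>\<C> = closed_convex X"
  define \<H> where "\<H> = {S. (clopen_upset X S \<or> clopen_downset X S) \<and> hit X S \<in> \<C>}"
  define K where "K = pts X - \<Union>\<H>"
  have openH: "openin (topo X) S" if "S \<in> \<H>" for S
    using that by (auto simp: \<H>_def clopen_upset_def clopen_downset_def)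
  have "K \<in> closed_convex X"
  proof -
    have "closedin (topo X) K"
      unfolding K_def using openH by (intro closedin_diff) auto
    moreover have "z \<in> K" if "x \<in> K" "y \<in> K" "(x, z) \<in> le X" "(z, y) \<in> le X" for x y z
    proof -
      have "z \<notin> S" if "S \<in> \<H>" for S
      proof
        assume "z \<in> S"
        have "clopen_upset X S \<or> clopen_downset X S"
          using \<open>S \<in> \<H>\<close> by (simp add: \<H>_def)
        then have "x \<in> S \<or> y \<in> S"
          using \<open>z \<in> S\<close> \<open>(x, z) \<in> le X\<close> \<open>(z, y) \<in> le X\<close>
          unfolding clopen_upset_def clopen_downset_def by blast
        then show False
          using \<open>S \<in> \<H>\<close> \<open>x \<in> K\<close> \<open>y \<in> K\<close> by (auto simp: K_def)
      qed
      moreover have "z \<in> pts X"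
        using \<open>(x, z) \<in> le X\<close> priestley_space_le(1) [OF X] by blast
      ultimately show ?thesis
        by (simp add: K_def)
    qed
    ultimately show ?thesis
      unfolding closed_convex_def by blast
  qed
  then obtain \<S> where \<S>: "\<S> \<in> \<C>" "K \<in> \<S>"
    using cov by blast
  have not_hit: "\<S> \<noteq> hit X S" if "clopen_upset X S \<or> clopen_downset X S" for S
  proof
    assume eq: "\<S> = hit X S"
    then have "S \<in> \<H>"
      using \<S>(1) that by (simp add: \<H>_def)
    then have "K \<inter> S = {}"
      by (auto simp: K_def)
    then show False
      using \<S>(2) eq by simp
  qed
  have "\<S> \<in> vietoris_subbase X"
    using \<S>(1) sub by (rule rev_subsetD)
  then obtain S where clopen: "clopen_upset X S \<or> clopen_downset X S"
    and hit_or_miss: "\<S> = hit X S \<or> \<S> = miss X S"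
    by (rule vietoris_subbaseE)
  have S: "\<S> = miss X S"
    by (rule disjE [OF hit_or_miss], rule notE [OF not_hit [OF clopen]])
  have "closedin (topo X) S"
    using clopen by (auto simp: clopen_upset_def clopen_downset_def)
  then have comp: "compactin (topo X) S" and SX: "S \<subseteq> pts X"
    using X by (simp_all add: closedin_compact_space priestley_space_def closedin_subset)
  have "S \<subseteq> \<Union>\<H>"
    using \<S>(2) SX unfolding S K_def by blast
  then obtain \<F> where \<F>: "finite \<F>" "\<F> \<subseteq> \<H>" "S \<subseteq> \<Union>\<F>"
    using compactinD [OF comp openH, of \<H>] by auto
  let ?\<C>' = "insert (miss X S) (hit X ` \<F>)"
  have sub': "?\<C>' \<subseteq> \<C>"
    using \<F>(2) \<S>(1) S by (auto simp: \<H>_def)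
  \<comment> \<open>If \<open>C\<close> meets \<open>S\<close>, the common point lies in some member
    of \<open>\<F>\<close>, so \<open>C\<close> is in the hit set of that member; otherwise
    \<open>C\<close> misses \<open>S\<close>.\<close>
  have "C \<in> \<Union>?\<C>'" if "C \<in> closed_convex X" for C
    using \<F>(3) that by auto
  then have "\<Union>?\<C>' = closed_convex X"
    by (intro equalityI subsetI) auto
  then show "\<exists>\<C>'. finite \<C>' \<and> \<C>' \<subseteq> \<C> \<and> \<Union>\<C>' = closed_convex X"
    using \<F>(1) sub' by (intro exI [of _ ?\<C>']) simp
qed

section \<open>Convexity and the Egli-Milner order\<close>

text \<open>Reflexivity gives one inclusion for every closed set; the other one is convexity. This
  translates condition (3) on a relation into membership in the carrier of the Vietoris
  space.\<close>

lemma closed_convex_iff: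
  assumes X: "priestley_space X" and C: "closedin (topo X) C"
  shows "C \<in> closed_convex X \<longleftrightarrow> C = up X C \<inter> down X C"
proof -
  have "C \<subseteq> up X C \<inter> down X C"
    using priestley_space_le(2) [OF X] closedin_subset [OF C] unfolding up_def down_def by blast
  moreover have "C \<in> closed_convex X \<longleftrightarrow> up X C \<inter> down X C \<subseteq> C"
    using C unfolding closed_convex_def up_def down_def by blast
  ultimately show ?thesis
    by (simp add: set_eq_subset)
qed

lemma closed_convexD:
  assumes "priestley_space X" "C \<in> closed_convex X"
  shows "C = up X C \<inter> down X C"
proof -
  have "closedin (topo X) C"
    using assms(2) by (simp add: closed_convex_def)
  from closed_convex_iff [OF assms(1) this] assms(2) show ?thesis
    by (rule iffD1)
qed

text \<open>Convexity is what turns the Egli-Milner preorder into an order: the four inclusions put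
  each set into the convex hull of the other, which is that other set.\<close>

lemma egli_milner_antisym:
  assumes X: "priestley_space X" and AB: "(A, B) \<in> egli_milner X" "(B, A) \<in> egli_milner X"
  shows "A = B"
proof (rule equalityI)
  have cc: "A \<in> closed_convex X" "B \<in> closed_convex X"
    using AB by (simp_all add: egli_milner_def)
  have "A \<subseteq> up X B \<inter> down X B" "B \<subseteq> up X A \<inter> down X A"
    using AB by (simp_all add: egli_milner_def)
  then show "A \<subseteq> B" "B \<subseteq> A"
    using equalityD2 [OF closed_convexD [OF X cc(1)]] equalityD2 [OF closed_convexD [OF X cc(2)]]
    by (meson order_trans)+
qed

lemma partial_order_egli_milner:
  assumes X: "priestley_space X"
  shows "partial_order_on (closed_convex X) (egli_milner X)"
proof -
  note le = priestley_space_le [OF X]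
  have "refl_on (closed_convex X) (egli_milner X)"
  proof (rule refl_onI)
    fix A
    assume A: "A \<in> closed_convex X"
    show "(A, A) \<in> egli_milner X"
      using A equalityD1 [OF closed_convexD [OF X A]] by (simp add: egli_milner_def)
  qed
  moreover have "trans (egli_milner X)"
  proof (rule transI)
    have mono: "down X B \<subseteq> down X C" if "B \<subseteq> down X C" for B C
      using that le(3) unfolding down_def by blast
    have mono': "up X B \<subseteq> up X A" if "B \<subseteq> up X A" for A B
      using that le(3) unfolding up_def by blast
    fix A B C
    assume "(A, B) \<in> egli_milner X" "(B, C) \<in> egli_milner X"
    then have "A \<in> closed_convex X" "C \<in> closed_convex X"
      "A \<subseteq> down X B" "B \<subseteq> up X A" "B \<subseteq> down X C" "C \<subseteq> up X B"
      by (simp_all add: egli_milner_def)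
    moreover from this have "A \<subseteq> down X C" "C \<subseteq> up X A"
      using mono [of B C] mono' [of B A] by simp_all
    ultimately show "(A, C) \<in> egli_milner X"
      by (simp add: egli_milner_def)
  qed
  moreover have "antisym (egli_milner X)"
    using egli_milner_antisym [OF X] by (rule antisymI)
  ultimately show ?thesis
    unfolding partial_order_on_def preorder_on_def egli_milner_def by auto
qed

lemma fob_Vietoris [simp]:
  "topo (fob Vietoris X) = vietoris_topology X" "le (fob Vietoris X) = egli_milner X"
  by (simp_all add: Vietoris_def)

text \<open>The second family consists of the closed convex sets contained in \<open>U\<close>. Each
  half of the Egli-Milner order serves one family: \<open>A \<subseteq> down X B\<close> carries a
  point of \<open>U\<close> upwards into \<open>B\<close>, and \<open>B \<subseteq> up X A\<close>
  keeps \<open>B\<close> inside \<open>U\<close>.\<close>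

lemma clopen_upset_vietoris:
  assumes X: "priestley_space X" and U: "clopen_upset X U"
  shows "clopen_upset (fob Vietoris X) (hit X U)"
    "clopen_upset (fob Vietoris X) (miss X (pts X - U))"
proof -
  have D: "clopen_downset X (pts X - U)"
    using X U by (rule clopen_downset_Diff)
  have hit: "B \<in> hit X U" if AB: "A \<in> hit X U" "(A, B) \<in> egli_milner X" for A B
  proof -
    have "A \<subseteq> down X B" "B \<in> closed_convex X"
      using AB(2) by (simp_all add: egli_milner_def)
    moreover have "\<And>x y. x \<in> U \<Longrightarrow> (x, y) \<in> le X \<Longrightarrow> y \<in> U"
      using U unfolding clopen_upset_def by blast
    ultimately show ?thesis
      using AB(1) unfolding down_def by blast
  qed
  show "clopen_upset (fob Vietoris X) (hit X U)"
    unfolding clopen_upset_def [of "fob Vietoris X"] fob_Vietoris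
    by (intro conjI allI impI openin_vietoris closedin_vietoris disjI1 U) (elim conjE, rule hit)
  have miss: "B \<in> miss X (pts X - U)" if AB: "A \<in> miss X (pts X - U)" "(A, B) \<in> egli_milner X" for A B
  proof -
    have "B \<subseteq> up X A" "B \<in> closed_convex X"
      using AB(2) by (simp_all add: egli_milner_def)
    moreover have "\<And>x y. x \<in> U \<Longrightarrow> (x, y) \<in> le X \<Longrightarrow> y \<in> U"
      using U unfolding clopen_upset_def by blast
    moreover have "A \<subseteq> U"
      using AB closedin_subset [of "topo X" A] by (auto simp: closed_convex_def)
    ultimately show ?thesis
      unfolding up_def by blast
  qed
  show "clopen_upset (fob Vietoris X) (miss X (pts X - U))"
    unfolding clopen_upset_def [of "fob Vietoris X"] fob_Vietoris
    by (intro conjI allI impI openin_vietoris closedin_vietoris disjI2 D) (elim conjE, rule miss)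
qed

lemma priestley_space_Vietoris:
  assumes X: "priestley_space X"
  shows "priestley_space (fob Vietoris X)"
  unfolding priestley_space_def
proof (intro conjI ballI impI)
  show "compact_space (topo (fob Vietoris X))"
    by (simp add: compact_space_vietoris X)
  show "partial_order_on (pts (fob Vietoris X)) (le (fob Vietoris X))"
    by (simp add: partial_order_egli_milner X)
next
  fix A B
  assume AB: "A \<in> pts (fob Vietoris X)" "B \<in> pts (fob Vietoris X)" "(A, B) \<notin> le (fob Vietoris X)"
  then have cc: "A \<in> closed_convex X" "B \<in> closed_convex X"
    by auto
  then have cl: "closedin (topo X) A" "closedin (topo X) B"
    by (auto simp: closed_convex_def)
  \<comment> \<open>The order can fail in two ways. A point \<open>a\<close> is detected by a hit
    set, a point \<open>b\<close> by the sets contained in a clopen upset.\<close>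
  consider a where "a \<in> A" "a \<notin> down X B" | b where "b \<in> B" "b \<notin> up X A"
    using AB(3) cc by (auto simp: egli_milner_def)
  then show "\<exists>\<U>. clopen_upset (fob Vietoris X) \<U> \<and> A \<in> \<U> \<and> B \<notin> \<U>"
  proof cases
    case 1
    then obtain U where "clopen_upset X U" "a \<in> U" "U \<inter> B = {}"
      using separate_point_from_closed [OF X cl(2)] closedin_subset [OF cl(1)] by blast
    then show ?thesis
      using clopen_upset_vietoris(1) [OF X] 1 cc by (intro exI [of _ "hit X U"]) auto
  next
    case 2
    then obtain U where "clopen_upset X U" "A \<subseteq> U" "b \<notin> U"
      using separate_closed_from_point [OF X cl(1)] closedin_subset [OF cl(2)] by blast
    then show ?thesis
      using clopen_upset_vietoris(2) [OF X] 2 cc closedin_subset [OF cl(2)]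
      by (intro exI [of _ "miss X (pts X - U)"]) auto
  qed
qed

section \<open>Passing between relations and coalgebra structures\<close>

text \<open>The restriction makes the map extensional, as \<open>ps_hom\<close> demands.\<close>

definition succ_map :: "'a ospace \<Rightarrow> 'a rel \<Rightarrow> 'a \<Rightarrow> 'a set" where
  "succ_map X R = (\<lambda>x\<in>pts X. R `` {x})"

text \<open>The guard on \<open>x\<close> discards the undefined values of \<open>\<rho>\<close>
  outside the carrier; it is what makes the two translations mutually inverse.\<close>

definition succ_rel :: "'a ospace \<Rightarrow> ('a \<Rightarrow> 'a set) \<Rightarrow> 'a rel" where
  "succ_rel X \<rho> = {(x, y). x \<in> pts X \<and> y \<in> \<rho> x}"

lemma succ_rel_Image: "x \<in> pts X \<Longrightarrow> succ_rel X \<rho> `` {x} = \<rho> x"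
  by (auto simp: succ_rel_def)

lemma box_succ_rel: "box X (succ_rel X \<rho>) U = {x \<in> pts X. \<rho> x \<subseteq> U}"
  by (auto simp: box_def succ_rel_def)

lemma diamond_succ_rel: "diamond X (succ_rel X \<rho>) U = {x \<in> pts X. \<rho> x \<inter> U \<noteq> {}}"
  by (auto simp: diamond_def succ_rel_def)

lemma succ_rel_succ_map:
  assumes "R \<subseteq> pts X \<times> pts X"
  shows "succ_rel X (succ_map X R) = R"
  using assms by (auto simp: succ_rel_def succ_map_def)

lemma succ_map_succ_rel:
  assumes "\<rho> \<in> extensional (pts X)"
  shows "succ_map X (succ_rel X \<rho>) = \<rho>"
  using assms by (auto simp: succ_map_def succ_rel_Image restrict_def extensional_def fun_eq_iff)

lemma succ_map_in_ps_hom: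
  assumes M: "modal_priestley_space X R"
  shows "succ_map X R \<in> ps_hom X (fob Vietoris X)"
proof -
  have X: "priestley_space X" and RX: "R \<subseteq> pts X \<times> pts X"
    and cl: "\<And>x. x \<in> pts X \<Longrightarrow> closedin (topo X) (R `` {x})"
    and box: "\<And>U. clopen_upset X U \<Longrightarrow> clopen_upset X (box X R U)"
    and dia: "\<And>U. clopen_upset X U \<Longrightarrow> clopen_upset X (diamond X R U)"
    and cv: "\<And>x. x \<in> pts X \<Longrightarrow> R `` {x} = up X (R `` {x}) \<inter> down X (R `` {x})"
    using M by (auto simp: modal_priestley_space_def)
  have cc: "R `` {x} \<in> closed_convex X" if "x \<in> pts X" for x
    using closed_convex_iff [OF X] cl cv that by blast
  \<comment> \<open>Condition (2) speaks of upsets only. For a downset, the diamond is the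
    complement of the box of the complementary upset.\<close>
  have clopen: "openin (topo X) (diamond X R S) \<and> closedin (topo X) (diamond X R S)"
    if S: "clopen_upset X S \<or> clopen_downset X S" for S
    using S
  proof
    assume "clopen_upset X S"
    then show ?thesis
      using dia by (simp add: clopen_upset_def)
  next
    assume "clopen_downset X S"
    then have "clopen_downset X (pts X - box X R (pts X - S))"
      using X box clopen_upset_Diff clopen_downset_Diff by blast
    moreover have "pts X - box X R (pts X - S) = diamond X R S"
      using RX by (auto simp: box_def diamond_def)
    ultimately show ?thesis
      by (simp add: clopen_downset_def)
  qed
  have "continuous_map (topo X) (vietoris_topology X) (succ_map X R)"
    unfolding vietoris_topology_eq
  proof (rule continuous_on_generated_topo)
    fix \<U>
    assume "\<U> \<in> vietoris_subbase X"
    then obtain S where S: "clopen_upset X S \<or> clopen_downset X S"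
      and \<U>: "\<U> = hit X S \<or> \<U> = miss X S"
      by (rule vietoris_subbaseE)
    have "openin (topo X) (pts X - diamond X R S)"
      using clopen [OF S] by blast
    \<comment> \<open>Preimages of generators are diamonds and their complements, so continuity
      reduces to the clopen diamonds above.\<close>
    moreover have "succ_map X R -` hit X S \<inter> pts X = diamond X R S"
      "succ_map X R -` miss X S \<inter> pts X = pts X - diamond X R S"
      using cc by (auto simp: succ_map_def diamond_def)
    ultimately show "openin (topo X) (succ_map X R -` \<U> \<inter> pts X)"
      using clopen [OF S] \<U> by (elim disjE) simp_all
  qed (use cc in \<open>auto simp: Union_vietoris_subbase succ_map_def\<close>)
  moreover have "(succ_map X R x, succ_map X R y) \<in> egli_milner X" if xy: "(x, y) \<in> le X" for x y
  proof -
    have x: "x \<in> pts X" and y: "y \<in> pts X"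
      using xy priestley_space_le(1) [OF X] by auto
    \<comment> \<open>A successor \<open>z\<close> of \<open>x\<close> below no successor of
      \<open>y\<close> would yield a clopen upset \<open>U\<close> whose diamond contains
      \<open>x\<close> but not \<open>y\<close>. The other half uses a box in the same way.\<close>
    have "R `` {x} \<subseteq> down X (R `` {y})"
    proof (rule ccontr)
      assume "\<not> ?thesis"
      then obtain z where z: "(x, z) \<in> R" "z \<notin> down X (R `` {y})"
        by blast
      then obtain U where U: "clopen_upset X U" "z \<in> U" "U \<inter> R `` {y} = {}"
        using separate_point_from_closed [OF X cl [OF y]] RX by blast
      then have "x \<in> diamond X R U" "y \<notin> diamond X R U"
        using x z by (auto simp: diamond_def)
      then show False
        using dia [OF U(1)] xy unfolding clopen_upset_def by blast
    qed
    moreover have "R `` {y} \<subseteq> up X (R `` {x})"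
    proof (rule ccontr)
      assume "\<not> ?thesis"
      then obtain z where z: "(y, z) \<in> R" "z \<notin> up X (R `` {x})"
        by blast
      then obtain U where U: "clopen_upset X U" "R `` {x} \<subseteq> U" "z \<notin> U"
        using separate_closed_from_point [OF X cl [OF x]] RX by blast
      then have "x \<in> box X R U" "y \<notin> box X R U"
        using x z by (auto simp: box_def)
      then show False
        using box [OF U(1)] xy unfolding clopen_upset_def by blast
    qed
    ultimately show ?thesis
      using x y cc by (simp add: succ_map_def egli_milner_def)
  qed
  ultimately show ?thesis
    using X priestley_space_Vietoris [OF X] by (auto simp: ps_hom_def succ_map_def)
qed

text \<open>Diamonds are preimages of clopen hit sets, hence clopen. Monotonicity of
  \<open>\<rho>\<close> makes them upsets through the lower half of the Egli-Milner order, and makes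
  boxes upsets through the upper half.\<close>

lemma modal_priestley_space_succ_rel:
  assumes \<rho>: "\<rho> \<in> ps_hom X (fob Vietoris X)"
  shows "modal_priestley_space X (succ_rel X \<rho>)"
proof -
  have X: "priestley_space X" and cont: "continuous_map (topo X) (vietoris_topology X) \<rho>"
    and mono: "\<And>x y. (x, y) \<in> le X \<Longrightarrow> (\<rho> x, \<rho> y) \<in> egli_milner X"
    using \<rho> by (auto simp: ps_hom_def)
  have cc: "\<rho> x \<in> closed_convex X" if "x \<in> pts X" for x
    using continuous_map_image_subset_topspace [OF cont] that by auto
  then have cl: "closedin (topo X) (\<rho> x)" if "x \<in> pts X" for x
    using that by (auto simp: closed_convex_def)
  have clopen: "openin (topo X) (diamond X (succ_rel X \<rho>) S) \<and>
      closedin (topo X) (diamond X (succ_rel X \<rho>) S)"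
    if S: "clopen_upset X S \<or> clopen_downset X S" for S
  proof -
    have "{x \<in> pts X. \<rho> x \<in> hit X S} = diamond X (succ_rel X \<rho>) S"
      using cc by (auto simp: diamond_succ_rel)
    then show ?thesis
      using openin_continuous_map_preimage [OF cont openin_vietoris(1) [OF S]]
        closedin_continuous_map_preimage [OF cont closedin_vietoris(1) [OF S]]
      by simp
  qed
  have "clopen_upset X (diamond X (succ_rel X \<rho>) U)" if U: "clopen_upset X U" for U
  proof -
    have "y \<in> diamond X (succ_rel X \<rho>) U"
      if x: "x \<in> diamond X (succ_rel X \<rho>) U" and xy: "(x, y) \<in> le X" for x y
    proof -
      obtain z where "z \<in> \<rho> x" "z \<in> U"
        using x by (auto simp: diamond_succ_rel)
      moreover from this obtain w where "w \<in> \<rho> y" "(z, w) \<in> le X"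
        using mono [OF xy] unfolding egli_milner_def down_def by blast
      ultimately have "w \<in> \<rho> y" "w \<in> U"
        using U unfolding clopen_upset_def by blast+
      moreover have "y \<in> pts X"
        using xy priestley_space_le(1) [OF X] by blast
      ultimately show ?thesis
        by (auto simp: diamond_succ_rel)
    qed
    then show ?thesis
      using clopen [of U] U unfolding clopen_upset_def by blast
  qed
  moreover have "clopen_upset X (box X (succ_rel X \<rho>) U)" if U: "clopen_upset X U" for U
  proof -
    have "y \<in> box X (succ_rel X \<rho>) U"
      if x: "x \<in> box X (succ_rel X \<rho>) U" and xy: "(x, y) \<in> le X" for x y
    proof -
      have "\<rho> x \<subseteq> U"
        using x by (simp add: box_succ_rel)
      moreover have "\<rho> y \<subseteq> up X (\<rho> x)"
        using mono [OF xy] by (simp add: egli_milner_def)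
      ultimately have "\<rho> y \<subseteq> U"
        using U unfolding clopen_upset_def up_def by blast
      moreover have "y \<in> pts X"
        using xy priestley_space_le(1) [OF X] by blast
      ultimately show ?thesis
        by (simp add: box_succ_rel)
    qed
    \<comment> \<open>Each \<open>\<rho> x\<close> lies in the carrier, so a box is the complement
      of the diamond of a clopen downset; this is why \<open>clopen\<close> covers downsets
      too.\<close>
    moreover have "box X (succ_rel X \<rho>) U = pts X - diamond X (succ_rel X \<rho>) (pts X - U)"
    proof (rule set_eqI)
      fix x
      have "\<rho> x \<subseteq> U \<longleftrightarrow> \<rho> x \<inter> (pts X - U) = {}" if "x \<in> pts X"
        using closedin_subset [OF cl [OF that]] by blast
      then show "x \<in> box X (succ_rel X \<rho>) U \<longleftrightarrow> x \<in> pts X - diamond X (succ_rel X \<rho>) (pts X - U)"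
        by (auto simp: box_succ_rel diamond_succ_rel)
    qed
    ultimately show ?thesis
      using clopen [of "pts X - U"] clopen_downset_Diff [OF X U]
      unfolding clopen_upset_def by (metis closedin_diff closedin_topspace openin_diff openin_topspace)
  qed
  moreover have "succ_rel X \<rho> \<subseteq> pts X \<times> pts X"
    using closedin_subset [OF cl] by (auto simp: succ_rel_def)
  moreover have "succ_rel X \<rho> `` {x} = up X (succ_rel X \<rho> `` {x}) \<inter> down X (succ_rel X \<rho> `` {x})"
    if "x \<in> pts X" for x
    unfolding succ_rel_Image [OF that] by (rule closed_convexD [OF X cc [OF that]])
  moreover have "closedin (topo X) (succ_rel X \<rho> `` {x})" if "x \<in> pts X" for x
    unfolding succ_rel_Image [OF that] by (rule cl [OF that])
  ultimately show ?thesis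
    unfolding modal_priestley_space_def using X by blast
qed

section \<open>Coalgebra morphisms and p-morphisms\<close>

text \<open>At a point \<open>x\<close> the coalgebra square says that the convex hull of the image
  of \<open>R1[x]\<close> equals \<open>R2[f x]\<close>. One inclusion is the forth condition,
  because \<open>R2[f x]\<close> is convex; the other is the back condition written out.\<close>

lemma coalg_hom_succ_map_iff:
  assumes M1: "modal_priestley_space X1 R1" and M2: "modal_priestley_space X2 R2"
    and f: "f \<in> extensional (pts X1)" "continuous_map (topo X1) (topo X2) f"
  shows "f \<in> coalg_hom Vietoris (X1, succ_map X1 R1) (X2, succ_map X2 R2) \<longleftrightarrow>
         p_morphism X1 R1 X2 R2 f"
proof -
  have X: "priestley_space X1" "priestley_space X2"
    and R1: "R1 \<subseteq> pts X1 \<times> pts X1"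
    and cv: "\<And>x. x \<in> pts X2 \<Longrightarrow> R2 `` {x} = up X2 (R2 `` {x}) \<inter> down X2 (R2 `` {x})"
    using M1 M2 by (auto simp: modal_priestley_space_def)
  note refl = priestley_space_le(2) [OF X(2)]
  have fX: "f x \<in> pts X2" if "x \<in> pts X1" for x
    using continuous_map_image_subset_topspace [OF f(2)] that by auto
  have cc: "R1 `` {x} \<in> closed_convex X1" if "x \<in> pts X1" for x
    using M1 that closed_convex_iff [OF X(1)] unfolding modal_priestley_space_def by blast
  \<comment> \<open>\<open>V x\<close> is the value of the functor's map on \<open>R1[x]\<close>; by
    \<open>cc\<close> this argument lies in the domain to which that map is restricted.\<close>
  define V where "V x = up X2 (f ` R1 `` {x}) \<inter> down X2 (f ` R1 `` {x})" for x
  have "compose (pts X1) (fmap Vietoris X1 X2 f) (succ_map X1 R1) = compose (pts X1) (succ_map X2 R2) f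
      \<longleftrightarrow> (\<forall>x\<in>pts X1. V x = R2 `` {f x})"
    using cc fX
    by (auto simp: fun_eq_iff compose_def restrict_def Vietoris_def succ_map_def V_def)
  also have "\<dots> \<longleftrightarrow> (\<forall>x z. (x, z) \<in> R1 \<longrightarrow> (f x, f z) \<in> R2) \<and>
     (\<forall>x\<in>pts X1. \<forall>y. (f x, y) \<in> R2 \<longrightarrow>
        (\<exists>z z'. (x, z) \<in> R1 \<and> (x, z') \<in> R1 \<and> (f z, y) \<in> le X2 \<and> (y, f z') \<in> le X2))"
    (is "_ \<longleftrightarrow> ?forth \<and> ?back")
  proof (intro iffI conjI)
    assume eq: "\<forall>x\<in>pts X1. V x = R2 `` {f x}"
    show ?back
      using eq unfolding V_def up_def down_def by blast
    show ?forth
    proof (intro allI impI)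
      fix x z
      assume "(x, z) \<in> R1"
      then have "x \<in> pts X1" "f z \<in> V x"
        using R1 fX refl by (auto simp: V_def up_def down_def)
      then show "(f x, f z) \<in> R2"
        using eq by auto
    qed
  next
    assume fb: "?forth \<and> ?back"
    show "\<forall>x\<in>pts X1. V x = R2 `` {f x}"
    proof
      fix x
      assume x: "x \<in> pts X1"
      have "f ` R1 `` {x} \<subseteq> R2 `` {f x}"
        using fb by auto
      then have "V x \<subseteq> up X2 (R2 `` {f x}) \<inter> down X2 (R2 `` {f x})"
        unfolding V_def up_def down_def by blast
      moreover have "R2 `` {f x} \<subseteq> V x"
        using fb x unfolding V_def up_def down_def by blast
      \<comment> \<open>The hull of a subset of \<open>R2[f x]\<close> stays inside by
        \<open>cv\<close>.\<close>
      ultimately show "V x = R2 `` {f x}"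
        using cv [OF fX [OF x]] by blast
    qed
  qed
  finally show ?thesis
    using X f fX unfolding coalg_hom_def p_morphism_def ps_hom_def by auto
qed

text \<open>The hom-sets coincide literally, so both functors can leave morphisms unchanged.\<close>

lemma coalg_hom_eq_MPS_hom:
  assumes "modal_priestley_space X1 R1" "modal_priestley_space X2 R2"
  shows "coalg_hom Vietoris (X1, succ_map X1 R1) (X2, succ_map X2 R2) = Hom MPS (X1, R1) (X2, R2)"
proof (rule set_eqI)
  fix f
  have "f \<in> coalg_hom Vietoris (X1, succ_map X1 R1) (X2, succ_map X2 R2) \<Longrightarrow>
      f \<in> extensional (pts X1) \<and> continuous_map (topo X1) (topo X2) f"
    by (auto simp: coalg_hom_def ps_hom_def)
  then show "f \<in> coalg_hom Vietoris (X1, succ_map X1 R1) (X2, succ_map X2 R2) \<longleftrightarrow>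
      f \<in> Hom MPS (X1, R1) (X2, R2)"
    using coalg_hom_succ_map_iff [OF assms, of f] unfolding MPS_def by auto
qed

section \<open>The category of modal Priestley spaces\<close>

lemma p_morphism_ident:
  assumes "modal_priestley_space X R"
  shows "p_morphism X R X R (\<lambda>x\<in>pts X. x)"
proof -
  have "priestley_space X" and R: "R \<subseteq> pts X \<times> pts X"
    using assms by (auto simp: modal_priestley_space_def)
  note le = priestley_space_le [OF this(1)]
  show ?thesis
    unfolding p_morphism_def
  proof (intro conjI allI ballI impI)
    fix x y
    assume "x \<in> pts X" "((\<lambda>x\<in>pts X. x) x, y) \<in> R"
    then have "(x, y) \<in> R" "y \<in> pts X"
      using R by auto
    then show "\<exists>z z'. (x, z) \<in> R \<and> (x, z') \<in> R \<and> ((\<lambda>x\<in>pts X. x) z, y) \<in> le X \<and>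
        (y, (\<lambda>x\<in>pts X. x) z') \<in> le X"
      \<comment> \<open>By reflexivity \<open>y\<close> is its own lower and upper bound.\<close>
      using le(2) by (intro exI [of _ y]) auto
  qed (use le(1) R in auto)
qed

lemma p_morphism_compose:
  assumes "modal_priestley_space X1 R1" "modal_priestley_space X3 R3"
    and f: "p_morphism X1 R1 X2 R2 f" and g: "p_morphism X2 R2 X3 R3 g"
  shows "p_morphism X1 R1 X3 R3 (compose (pts X1) g f)"
proof -
  have X: "priestley_space X1" "priestley_space X3" and R1: "R1 \<subseteq> pts X1 \<times> pts X1"
    using assms by (auto simp: modal_priestley_space_def)
  note le = priestley_space_le(1) [OF X(1)] priestley_space_le(3) [OF X(2)]
  have [simp]: "compose (pts X1) g f x = g (f x)" if "x \<in> pts X1" for x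
    using that by (simp add: compose_def)
  show ?thesis
    unfolding p_morphism_def
  proof (intro conjI allI ballI impI)
    fix x y
    assume x: "x \<in> pts X1" and "(compose (pts X1) g f x, y) \<in> R3"
    then have "f x \<in> pts X2" "(g (f x), y) \<in> R3"
      using f by (auto simp: p_morphism_def)
    then obtain w w' where w: "(f x, w) \<in> R2" "(f x, w') \<in> R2" "(g w, y) \<in> le X3" "(y, g w') \<in> le X3"
      using g unfolding p_morphism_def by blast
    \<comment> \<open>The back condition of \<open>f\<close> is used twice: its lower bound is kept
      for \<open>w\<close>, its upper bound for \<open>w'\<close>. Monotonicity of \<open>g\<close>
      then gives the chain
      \<open>g (f z) \<le> g w \<le> y \<le> g w' \<le> g (f z')\<close>.\<close>
    then obtain z z' where z: "(x, z) \<in> R1" "(f z, w) \<in> le X2" "(x, z') \<in> R1" "(w', f z') \<in> le X2"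
      using f x unfolding p_morphism_def by meson
    then have "(g (f z), y) \<in> le X3" "(y, g (f z')) \<in> le X3"
      using g w le(2) unfolding p_morphism_def by blast+
    then show "\<exists>z z'. (x, z) \<in> R1 \<and> (x, z') \<in> R1 \<and> (compose (pts X1) g f z, y) \<in> le X3 \<and>
        (y, compose (pts X1) g f z') \<in> le X3"
      using z R1 by (intro exI [of _ z] exI [of _ z']) auto
  next
    show "compose (pts X1) g f \<in> pts X1 \<rightarrow> pts X3"
      using f g by (auto simp: p_morphism_def)
  next
    fix x y
    assume xy: "(x, y) \<in> le X1"
    then have "x \<in> pts X1" "y \<in> pts X1"
      using le(1) by auto
    then show "(compose (pts X1) g f x, compose (pts X1) g f y) \<in> le X3"
      using f g xy by (simp add: p_morphism_def)
  next
    fix x z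
    assume xz: "(x, z) \<in> R1"
    then have "x \<in> pts X1" "z \<in> pts X1"
      using R1 by auto
    then show "(compose (pts X1) g f x, compose (pts X1) g f z) \<in> R3"
      using f g xz by (simp add: p_morphism_def)
  qed
qed

lemma continuous_map_compose_pts:
  assumes "continuous_map S T f" "continuous_map T U g"
  shows "continuous_map S U (compose (topspace S) g f)"
  by (rule continuous_map_eq [OF continuous_map_compose [OF assms]]) (simp add: compose_def)

lemma category_MPS: "category (MPS :: ('a ospace \<times> 'a rel, 'a \<Rightarrow> 'a) cat)"
proof
  fix A :: "'a ospace \<times> 'a rel"
  assume "A \<in> Ob MPS"
  moreover have "continuous_map (topo X) (topo X) (\<lambda>x\<in>pts X. x)" for X :: "'a ospace"
    by (rule continuous_map_eq [OF continuous_map_id]) simp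
  ultimately show "Ident MPS A \<in> Hom MPS A A"
    by (auto simp: MPS_def p_morphism_ident)
next
  fix A B D :: "'a ospace \<times> 'a rel" and f g
  assume "A \<in> Ob MPS" "B \<in> Ob MPS" "D \<in> Ob MPS" "f \<in> Hom MPS A B" "g \<in> Hom MPS B D"
  then show "Comp MPS A B D g f \<in> Hom MPS A D"
    by (auto simp: MPS_def intro: p_morphism_compose continuous_map_compose_pts)
next
  fix A B :: "'a ospace \<times> 'a rel" and f
  assume "A \<in> Ob MPS" "B \<in> Ob MPS" "f \<in> Hom MPS A B"
  then show "Comp MPS A A B f (Ident MPS A) = f" "Comp MPS A B B (Ident MPS B) f = f"
    by (auto simp: MPS_def p_morphism_def compose_def fun_eq_iff extensional_def Pi_iff)
next
  fix A B D E :: "'a ospace \<times> 'a rel" and f g h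
  assume "A \<in> Ob MPS" "B \<in> Ob MPS" "D \<in> Ob MPS" "E \<in> Ob MPS"
    "f \<in> Hom MPS A B" "g \<in> Hom MPS B D" "h \<in> Hom MPS D E"
  then show "Comp MPS A D E h (Comp MPS A B D g f) = Comp MPS A B E (Comp MPS B D E h g) f"
    by (auto simp: MPS_def p_morphism_def compose_def fun_eq_iff Pi_iff)
qed

section \<open>Isomorphism by a bijection on objects\<close>

text \<open>When hom-sets, identities and composition agree along a bijection of objects,
  \<open>D\<close> is a relabelling of \<open>C\<close>. The category axioms for coalgebras thus
  follow from those for modal Priestley spaces.\<close>

lemma isomorphic_categoriesI:
  assumes C: "category C"
    and FG: "\<And>A. A \<in> Ob C \<Longrightarrow> F A \<in> Ob D \<and> G (F A) = A"
    and GF: "\<And>B. B \<in> Ob D \<Longrightarrow> G B \<in> Ob C \<and> F (G B) = B"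
    and Hom: "\<And>A B. \<lbrakk>A \<in> Ob C; B \<in> Ob C\<rbrakk> \<Longrightarrow> Hom D (F A) (F B) = Hom C A B"
    and Ident: "\<And>A. A \<in> Ob C \<Longrightarrow> Ident D (F A) = Ident C A"
    and Comp: "\<And>A B E. \<lbrakk>A \<in> Ob C; B \<in> Ob C; E \<in> Ob C\<rbrakk> \<Longrightarrow>
      Comp D (F A) (F B) (F E) = Comp C A B E"
  shows "isomorphic_categories C D"
proof -
  interpret category C
    by (fact C)
  \<comment> \<open>Rewriting all data of \<open>D\<close> through \<open>G\<close> reduces each
    axiom of \<open>D\<close> to the same axiom of \<open>C\<close>.\<close>
  have Hom': "Hom D A B = Hom C (G A) (G B)" if "A \<in> Ob D" "B \<in> Ob D" for A B
    using Hom [of "G A" "G B"] GF that by simp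
  have Ident': "Ident D A = Ident C (G A)" if "A \<in> Ob D" for A
    using Ident [of "G A"] GF that by simp
  have Comp': "Comp D A B E = Comp C (G A) (G B) (G E)"
    if "A \<in> Ob D" "B \<in> Ob D" "E \<in> Ob D" for A B E
    using Comp [of "G A" "G B" "G E"] GF that by simp
  have D: "category D"
    by unfold_locales
      (simp_all add: Hom' Ident' Comp' GF ident_in_hom comp_in_hom comp_ident_left
        comp_ident_right comp_assoc)
  show ?thesis
    unfolding isomorphic_categories_def
  proof (intro exI conjI)
    show "is_functor C D \<lparr>fob = F, fmap = \<lambda>_ _ f. f\<rparr>"
      using C D FG Hom Ident Comp by (simp add: is_functor_def)
    show "is_functor D C \<lparr>fob = G, fmap = \<lambda>_ _ f. f\<rparr>"
      using C D GF by (simp add: is_functor_def Hom' Ident' Comp')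
  qed (use FG GF in \<open>simp_all add: left_inverse_functor_def\<close>)
qed

theorem lemma5p9:
  shows "isomorphic_categories (MPS :: ('a ospace \<times> 'a rel, 'a \<Rightarrow> 'a) cat)
           (Coalg (Vietoris :: ('a ospace, 'a \<Rightarrow> 'a, 'a set ospace, 'a set \<Rightarrow> 'a set) fctr))"
proof (rule isomorphic_categoriesI)
  let ?F = "\<lambda>(X :: 'a ospace, R). (X, succ_map X R)"
  let ?G = "\<lambda>(X :: 'a ospace, \<rho>). (X, succ_rel X \<rho>)"
  show "category (MPS :: ('a ospace \<times> 'a rel, 'a \<Rightarrow> 'a) cat)"
    by (rule category_MPS)
  show "?F A \<in> Ob (Coalg Vietoris) \<and> ?G (?F A) = A" if A: "A \<in> Ob MPS" for A
  proof (cases A)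
    case (Pair X R)
    then have R: "modal_priestley_space X R"
      using A by (simp add: MPS_def)
    then have "priestley_space X" "R \<subseteq> pts X \<times> pts X"
      unfolding modal_priestley_space_def by blast+
    with R Pair show ?thesis
      by (simp add: Coalg_def succ_map_in_ps_hom succ_rel_succ_map)
  qed
  show "?G B \<in> Ob MPS \<and> ?F (?G B) = B" if B: "B \<in> Ob (Coalg Vietoris)" for B
  proof (cases B)
    case (Pair X \<rho>)
    then have "\<rho> \<in> ps_hom X (fob Vietoris X)"
      using B by (simp add: Coalg_def)
    moreover from this have "\<rho> \<in> extensional (pts X)"
      by (simp add: ps_hom_def)
    ultimately show ?thesis
      using Pair by (simp add: MPS_def modal_priestley_space_succ_rel succ_map_succ_rel)
  qed
  show "Hom (Coalg Vietoris) (?F A) (?F B) = Hom MPS A B" if "A \<in> Ob MPS" "B \<in> Ob MPS" for A B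
  proof (cases A; cases B)
    fix X1 R1 X2 R2
    assume "A = (X1, R1)" "B = (X2, R2)"
    then show ?thesis
      using that coalg_hom_eq_MPS_hom [of X1 R1 X2 R2] by (simp add: MPS_def Coalg_def)
  qed
\<comment> \<open>Identities and composition remain: in both categories they depend only on the
  carrier of the first space.\<close>
qed (auto simp: MPS_def Coalg_def)

end
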